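(* Consider the one-sided null $\Theta_0=(-\infty,0)\cap U$. Let $\mathcal{F}=\{F_\mu:\mu\in U\}$ be a Type I location-shift family such that $F_0$ is differentiable, $\int|x|\,dF_\mu(x)<\infty$ for each $\mu\in U$, and $$\int_0^t\frac1y\,dy\int_{-1}^1\left|\frac{d}{ds}\frac{1}{r_0(ys)}\right|ds<\infty\quad\text{for each }t>0 .$$ Set $$K_1^\dagger(t,x)=\frac1{2\pi}\int_0^1dy\int_{-1}^1\frac1{\iota y}\frac{d}{ds}\frac{\exp(\iota tysx)}{r_0(tys)}\,ds .$$ Then $$\psi_1(t,\mu):=\int K_1^\dagger(t,x)\,dF_\mu(x)=\frac1\pi\int_0^t\frac{\sin(\mu y)}{y}\,dy ,$$ and the pair $(\psi,K)$ given by $$K(t,x)=2^{-1}-\Re\{K_1^\dagger(t,x)\}-2^{-1}K_{1,0}(t,x;0),\qquad \psi(t,\mu)=2^{-1}-\psi_1(t,\mu)-2^{-1}\psi_{1,0}(t,\mu;0)$$ is a pair of discriminant function and matching function for $\Theta_0$; that is, for every $\mu\in U$, $\lim_{t\to\infty}\psi(t,\mu)=1_{(-\infty,0)}(\mu)$ and $\psi(t,\mu)=\int K(t,x)\,dF_\mu(x)$. Moreover, setting $K_1(t,x)=\Re\{K_1^\dagger(t,x)\}$, $$K_1(t,x)=\frac1{2\pi}\int_0^1dy\int_{-1}^1\left[\frac{\sin(ytsx)}{y}\left\{\frac{d}{ds}\frac1{r_0(tys)}\right\}+\frac{tx\cos(tysx)}{r_0(tys)}\right]ds .$$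
   Context: $U\subseteq\mathbb{R}$ is a non-empty known set with non-empty interior and $\mathcal{F}=\{F_\mu:\mu\in U\}$ is a family of CDFs on $\mathbb{R}$, each $F_\mu$ being uniquely determined by $\mu$ (its mean or median). $\mathcal{F}$ is a location-shift family if $z+\mu'$ has CDF $F_{\mu+\mu'}$ whenever $z$ has CDF $F_\mu$ and $\mu,\mu+\mu'\in U$. Let $\iota=\sqrt{-1}$, $\hat F_\mu(t)=\int e^{\iota tx}dF_\mu(x)$ and $r_\mu(t)=|\hat F_\mu(t)|$. $\mathcal{F}$ is a Type I location-shift family if it is a location-shift family for which $\hat F_0$ has no real zeros and $\hat F_0=r_0$ (so $0\in U$ is implicit). $\Re$ denotes real part. $\omega$ is an even, bounded probability density function on $[-1,1]$ of bounded variation. For $\mu'\in U$, $$K_{1,0}(t,x;\mu')=\int_{[-1,1]}\frac{\omega(s)\cos\{ts(x-\mu')\}}{r_{\mu'}(ts)}ds,\qquad \psi_{1,0}(t,\mu;\mu')=\int K_{1,0}(t,x;\mu')\,dF_\mu(x)$$ (the latter equals $\int_{[-1,1]}\omega(s)\cos\{ts(\mu-\mu')\}ds$). For a null set $\Theta_0$, a pair $(\psi,K)$ is a pair of discriminant function and matching function if, for every $\mu\in U$, $\lim_{t\to\infty}\psi(t,\mu)=1_{\Theta_0}(\mu)$, and $K:\mathbb{R}^2\to\mathbb{R}$ is a function of $(t,x)$ that does not depend on the parameter $\mu$ and satisfies $\psi(t,\mu)=\int K(t,x)\,dF_\mu(x)$ for all $\mu\in U$. An integral $\int dy\int g\,ds$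 denotes the iterated integral $\int(\int g\,ds)\,dy$. *)

theory Defs
  imports "HOL-Probability.Probability"
begin

definition is_cdf :: "(real \<Rightarrow> real) \<Rightarrow> bool" where
  "is_cdf G \<longleftrightarrow> mono G \<and> (\<forall>a. continuous (at_right a) G) \<and>
     (G \<longlongrightarrow> 0) at_bot \<and> (G \<longlongrightarrow> 1) at_top"

abbreviation law :: "(real \<Rightarrow> real \<Rightarrow> real) \<Rightarrow> real \<Rightarrow> real measure" where
  "law F \<mu> \<equiv> interval_measure (F \<mu>)"

definition is_mean :: "real measure \<Rightarrow> real \<Rightarrow> bool" where
  "is_mean M m \<longleftrightarrow> integrable M (\<lambda>x. x) \<and> (LINT x|M. x) = m"

definition is_median :: "real measure \<Rightarrow> real \<Rightarrow> bool" where
  "is_median M m \<longleftrightarrow> measure M {..m} \<ge> 1/2 \<and> measure M {m..} \<ge> 1/2"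

text \<open>A family of CDFs indexed by its mean or median; the values of \<open>F\<close> outside \<open>U\<close> are
  irrelevant.\<close>

definition cdf_family :: "real set \<Rightarrow> (real \<Rightarrow> real \<Rightarrow> real) \<Rightarrow> bool" where
  "cdf_family U F \<longleftrightarrow> U \<noteq> {} \<and> interior U \<noteq> {} \<and>
     (\<forall>\<mu>\<in>U. is_cdf (F \<mu>) \<and> (is_mean (law F \<mu>) \<mu> \<or> is_median (law F \<mu>) \<mu>))"

text \<open>The measure \<open>L\<close> below is the law of the random variable \<open>z\<close>.\<close>

definition location_shift_family :: "real set \<Rightarrow> (real \<Rightarrow> real \<Rightarrow> real) \<Rightarrow> bool" where
  "location_shift_family U F \<longleftrightarrow> cdf_family U F \<and>
     (\<forall>\<mu> \<mu>' L. \<mu> \<in> U \<longrightarrow> \<mu> + \<mu>' \<in> U \<longrightarrow> real_distribution L \<longrightarrow> cdf L = F \<mu> \<longrightarrow>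
        cdf (distr L borel (\<lambda>z. z + \<mu>')) = F (\<mu> + \<mu>'))"

definition Fhat :: "(real \<Rightarrow> real \<Rightarrow> real) \<Rightarrow> real \<Rightarrow> real \<Rightarrow> complex" where
  "Fhat F \<mu> t = char (law F \<mu>) t"

definition r :: "(real \<Rightarrow> real \<Rightarrow> real) \<Rightarrow> real \<Rightarrow> real \<Rightarrow> real" where
  "r F \<mu> t = cmod (Fhat F \<mu> t)"

definition type_I_location_shift_family ::
    "real set \<Rightarrow> (real \<Rightarrow> real \<Rightarrow> real) \<Rightarrow> bool" where
  "type_I_location_shift_family U F \<longleftrightarrow> location_shift_family U F \<and> 0 \<in> U \<and>
     (\<forall>t. Fhat F 0 t \<noteq> 0) \<and> (\<forall>t. Fhat F 0 t = complex_of_real (r F 0 t))"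

definition bounded_variation_on :: "real \<Rightarrow> real \<Rightarrow> (real \<Rightarrow> real) \<Rightarrow> bool" where
  "bounded_variation_on a b f \<longleftrightarrow>
     (\<exists>B. \<forall>n (x :: nat \<Rightarrow> real). mono_on {..n} x \<longrightarrow> x ` {..n} \<subseteq> {a..b} \<longrightarrow>
        (\<Sum>i<n. \<bar>f (x (Suc i)) - f (x i)\<bar>) \<le> B)"

definition admissible_weight :: "(real \<Rightarrow> real) \<Rightarrow> bool" where
  "admissible_weight \<omega> \<longleftrightarrow>
     (\<forall>s\<in>{-1..1}. 0 \<le> \<omega> s) \<and> set_integrable lborel {-1..1} \<omega> \<and> (LBINT s:{-1..1}. \<omega> s) = 1 \<and>
     (\<forall>s\<in>{-1..1}. \<omega> (- s) = \<omega> s) \<and> bounded (\<omega> ` {-1..1}) \<and> bounded_variation_on (-1) 1 \<omega>"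

definition K10 ::
    "(real \<Rightarrow> real \<Rightarrow> real) \<Rightarrow> (real \<Rightarrow> real) \<Rightarrow> real \<Rightarrow> real \<Rightarrow> real \<Rightarrow> real" where
  "K10 F \<omega> \<mu>' t x = (LBINT s:{-1..1}. \<omega> s * cos (t * s * (x - \<mu>')) / r F \<mu>' (t * s))"

definition psi10 ::
    "(real \<Rightarrow> real \<Rightarrow> real) \<Rightarrow> (real \<Rightarrow> real) \<Rightarrow> real \<Rightarrow> real \<Rightarrow> real \<Rightarrow> real" where
  "psi10 F \<omega> \<mu>' t \<mu> = (LINT x|law F \<mu>. K10 F \<omega> \<mu>' t x)"

text \<open>\<open>(\<psi>, K)\<close> is a pair of discriminant function and matching function for the null \<open>\<Theta>\<close>.
  Integrability is stated since the Bochner integral is total.\<close>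

definition discriminant_matching_pair ::
    "real set \<Rightarrow> (real \<Rightarrow> real \<Rightarrow> real) \<Rightarrow> real set \<Rightarrow>
     (real \<Rightarrow> real \<Rightarrow> real) \<Rightarrow> (real \<Rightarrow> real \<Rightarrow> real) \<Rightarrow> bool" where
  "discriminant_matching_pair U F \<Theta> \<psi> K \<longleftrightarrow>
     (\<forall>\<mu>\<in>U. ((\<lambda>t. \<psi> t \<mu>) \<longlongrightarrow> indicator \<Theta> \<mu>) at_top \<and>
        (\<forall>t. integrable (law F \<mu>) (K t) \<and> \<psi> t \<mu> = (LINT x|law F \<mu>. K t x)))"

text \<open>Existence of the iterated integral \<open>\<integral>\<^sub>A (\<integral>\<^sub>B g y s ds) dy\<close>, and its value.\<close>

definition iterated_integrable ::
    "real set \<Rightarrow> real set \<Rightarrow> (real \<Rightarrow> real \<Rightarrow> 'a::{banach, second_countable_topology}) \<Rightarrow> bool" where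
  "iterated_integrable A B g \<longleftrightarrow>
     (AE y in lborel. y \<in> A \<longrightarrow> set_integrable lborel B (g y)) \<and>
     set_integrable lborel A (\<lambda>y. LBINT s:B. g y s)"

definition iterated_integral ::
    "real set \<Rightarrow> real set \<Rightarrow> (real \<Rightarrow> real \<Rightarrow> 'a::{banach, second_countable_topology}) \<Rightarrow> 'a" where
  "iterated_integral A B g = (LBINT y:A. LBINT s:B. g y s)"

definition K1_dagger_integrand ::
    "(real \<Rightarrow> real \<Rightarrow> real) \<Rightarrow> real \<Rightarrow> real \<Rightarrow> real \<Rightarrow> real \<Rightarrow> complex" where
  "K1_dagger_integrand F t x y s =
     1 / (\<i> * complex_of_real y) *
     vector_derivative
       (\<lambda>s. exp (\<i> * complex_of_real (t * y * s * x)) / complex_of_real (r F 0 (t * y * s))) (at s)"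

definition K1_dagger :: "(real \<Rightarrow> real \<Rightarrow> real) \<Rightarrow> real \<Rightarrow> real \<Rightarrow> complex" where
  "K1_dagger F t x =
     1 / (2 * complex_of_real pi) * iterated_integral {0..1} {-1..1} (K1_dagger_integrand F t x)"

definition psi1 :: "(real \<Rightarrow> real \<Rightarrow> real) \<Rightarrow> real \<Rightarrow> real \<Rightarrow> complex" where
  "psi1 F t \<mu> = (LINT x|law F \<mu>. K1_dagger F t x)"

definition K1_integrand ::
    "(real \<Rightarrow> real \<Rightarrow> real) \<Rightarrow> real \<Rightarrow> real \<Rightarrow> real \<Rightarrow> real \<Rightarrow> real" where
  "K1_integrand F t x y s =
     sin (y * t * s * x) / y * deriv (\<lambda>s. 1 / r F 0 (t * y * s)) s +
     t * x * cos (t * y * s * x) / r F 0 (t * y * s)"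

definition K_one_sided ::
    "(real \<Rightarrow> real \<Rightarrow> real) \<Rightarrow> (real \<Rightarrow> real) \<Rightarrow> real \<Rightarrow> real \<Rightarrow> real" where
  "K_one_sided F \<omega> t x = 1/2 - Re (K1_dagger F t x) - 1/2 * K10 F \<omega> 0 t x"

text \<open>\<open>psi1\<close> is typed complex because \<open>K1_dagger\<close> is; it takes real values on \<open>U\<close>, so \<open>Re\<close>
  only converts the type.\<close>

definition psi_one_sided ::
    "(real \<Rightarrow> real \<Rightarrow> real) \<Rightarrow> (real \<Rightarrow> real) \<Rightarrow> real \<Rightarrow> real \<Rightarrow> real" where
  "psi_one_sided F \<omega> t \<mu> = 1/2 - Re (psi1 F t \<mu>) - 1/2 * psi10 F \<omega> 0 t \<mu>"

end

theory Submission
  imports Defs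
begin

text \<open>
  Write \<open>r\<close> for \<open>r F 0\<close>. A first moment makes \<open>r\<close>, the characteristic function of \<open>F 0\<close>,
  continuously differentiable. It is also even and positive, so
  \<open>g s = exp (\<i> t y s x) / r (t y s)\<close> is \<open>C\<^sup>1\<close>, and for \<open>y \<noteq> 0\<close> the inner integral in
  \<open>K1_dagger\<close> is given by the fundamental theorem of calculus:
  \<open>(g 1 - g (-1)) / (\<i> y) = 2 sin (t y x) / (y r (t y))\<close>. Hence \<open>K1_dagger F t x\<close> is real and
  equals \<open>1/\<pi>\<close> times the integral of \<open>sin (t y x) / (y r (t y))\<close> over \<open>0 \<le> y \<le> 1\<close>
  (\<open>K1_dagger_eq\<close>). The real part of the integrand of \<open>K1_dagger\<close> is the integrand of the real
  formula for \<open>K\<^sub>1\<close> when \<open>y \<noteq> 0\<close> (\<open>K1_integrand_eq_Re\<close>), hence off a null set.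

  The law of index \<open>\<mu>\<close> is the translate of that of index \<open>0\<close> by \<open>\<mu>\<close>, so the means of
  \<open>sin (u x)\<close> and \<open>cos (u x)\<close> under it are \<open>sin (u \<mu>) r u\<close> and \<open>cos (u \<mu>) r u\<close>. Exchanging
  integrals, with the bound \<open>|sin (t y x) / y| \<le> |t| |x|\<close> and the first moment, cancels the
  factor \<open>r\<close>. This leaves \<open>psi1\<close> as the stated sine integral (\<open>psi1_eq\<close>), and in the same way
  \<open>psi10\<close> as the cosine transform of \<open>\<omega>\<close> at \<open>t \<mu>\<close> (\<open>psi10_eq\<close>). As \<open>t\<close> grows, the
  former tends to \<open>sgn \<mu> / 2\<close> by the Dirichlet integral. The latter tends to \<open>0\<close> if
  \<open>\<mu> \<noteq> 0\<close>, by the Riemann--Lebesgue lemma, and is \<open>1\<close> if \<open>\<mu> = 0\<close>. So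
  \<open>1/2 - psi1 - psi10 / 2\<close> tends to \<open>1\<close> for \<open>\<mu> < 0\<close> and to \<open>0\<close> for \<open>\<mu> \<ge> 0\<close>.
\<close>

section \<open>The Riemann--Lebesgue lemma\<close>

lemma integrable_mult_cos:
  fixes f :: "real \<Rightarrow> real"
  assumes "integrable lborel f"
  shows "integrable lborel (\<lambda>x. f x * cos (t * x))"
  using assms borel_measurable_integrable[OF assms]
  by (intro Bochner_Integration.integrable_bound[OF assms])
     (auto simp: abs_mult intro!: mult_left_le)

text \<open>The functions whose cosine transform vanishes at infinity are closed under dominated
  pointwise limits, since the transform of \<open>f - s i\<close> is at most the \<open>L\<^sup>1\<close> norm of
  \<open>f - s i\<close>, uniformly in the frequency. The domination by \<open>2 * \<bar>f x\<bar>\<close> is the one that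
  \<open>integrable_induct\<close> supplies.\<close>

lemma tendsto_integral_cos_of_L1_limit:
  fixes f :: "real \<Rightarrow> real" and s :: "nat \<Rightarrow> real \<Rightarrow> real"
  assumes f: "integrable lborel f" and s: "\<And>i. integrable lborel (s i)"
    and lim: "\<And>x. (\<lambda>i. s i x) \<longlonglongrightarrow> f x"
    and bound: "\<And>i x. \<bar>s i x\<bar> \<le> 2 * \<bar>f x\<bar>"
    and osc: "\<And>i. ((\<lambda>t. LBINT x. s i x * cos (t * x)) \<longlongrightarrow> 0) at_top"
  shows "((\<lambda>t. LBINT x. f x * cos (t * x)) \<longlongrightarrow> 0) at_top"
proof (rule tendstoI)
  fix e :: real assume "e > 0"
  have "(\<lambda>i. LBINT x. \<bar>f x - s i x\<bar>) \<longlonglongrightarrow> (LBINT x::real. 0)"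
  proof (rule integral_dominated_convergence[where w = "\<lambda>x. 3 * \<bar>f x\<bar>"])
    show "AE x in lborel. (\<lambda>i. \<bar>f x - s i x\<bar>) \<longlonglongrightarrow> 0"
    proof (intro AE_I2)
      fix x
      have "(\<lambda>i. \<bar>f x - s i x\<bar>) \<longlonglongrightarrow> \<bar>f x - f x\<bar>"
        by (intro tendsto_intros lim)
      then show "(\<lambda>i. \<bar>f x - s i x\<bar>) \<longlonglongrightarrow> 0" by simp
    qed
    show "AE x in lborel. norm \<bar>f x - s i x\<bar> \<le> 3 * \<bar>f x\<bar>" for i
    proof (intro AE_I2)
      fix x show "norm \<bar>f x - s i x\<bar> \<le> 3 * \<bar>f x\<bar>" using bound[of i x] by simp
    qed
  qed (use f s in \<open>auto intro: borel_measurable_integrable\<close>)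
  then have "eventually (\<lambda>i. dist (LBINT x. \<bar>f x - s i x\<bar>) 0 < e / 2) sequentially"
    using \<open>e > 0\<close> by (intro tendstoD) auto
  then obtain i where i: "(LBINT x. \<bar>f x - s i x\<bar>) < e / 2"
    by (auto simp: eventually_sequentially dist_real_def)
  have "eventually (\<lambda>t. dist (LBINT x. s i x * cos (t * x)) 0 < e / 2) at_top"
    using osc[of i] \<open>e > 0\<close> by (intro tendstoD) auto
  then show "eventually (\<lambda>t. dist (LBINT x. f x * cos (t * x)) 0 < e) at_top"
  proof eventually_elim
    case (elim t)
    have "(LBINT x. f x * cos (t * x)) - (LBINT x. s i x * cos (t * x)) =
        (LBINT x. (f x - s i x) * cos (t * x))"
      by (simp add: left_diff_distrib integrable_mult_cos f s)
    moreover have "\<bar>LBINT x. (f x - s i x) * cos (t * x)\<bar> \<le> (LBINT x. \<bar>f x - s i x\<bar>)"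
    proof -
      have "\<bar>LBINT x. (f x - s i x) * cos (t * x)\<bar> \<le> (LBINT x. \<bar>(f x - s i x) * cos (t * x)\<bar>)"
        using integral_norm_bound[of lborel "\<lambda>x. (f x - s i x) * cos (t * x)"] by simp
      also have "\<dots> \<le> (LBINT x. \<bar>f x - s i x\<bar>)"
        by (intro integral_mono integrable_abs integrable_mult_cos Bochner_Integration.integrable_diff f s)
           (auto simp: abs_mult intro!: mult_left_le)
      finally show ?thesis .
    qed
    ultimately show ?case using elim i by (simp add: dist_real_def)
  qed
qed

lemma integral_interval_cos_tendsto_0:
  "((\<lambda>t. LBINT x. indicator {a..b} x * cos (t * x)) \<longlongrightarrow> 0) at_top" for a b :: real
proof (cases "a \<le> b")
  case True
  show ?thesis
  proof (rule Lim_null_comparison)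
    show "((\<lambda>t::real. 2 / t) \<longlongrightarrow> 0) at_top"
      by (intro tendsto_divide_0[OF tendsto_const] filterlim_at_top_imp_at_infinity filterlim_ident)
    show "\<forall>\<^sub>F t in at_top. norm (LBINT x. indicator {a..b} x * cos (t * x)) \<le> 2 / t"
      using eventually_gt_at_top[of 0]
    proof eventually_elim
      case (elim t)
      have "(LBINT x. cos (t * x) * indicator {a..b} x) = sin (t * b) / t - sin (t * a) / t"
        using elim by (intro integral_FTC_Icc_real True) (auto intro!: derivative_eq_intros)
      then have "norm (LBINT x. indicator {a..b} x * cos (t * x)) = \<bar>sin (t * b) - sin (t * a)\<bar> / t"
        using elim by (simp add: mult.commute flip: diff_divide_distrib)
      also have "\<dots> \<le> 2 / t"
        using abs_triangle_ineq4[of "sin (t * b)" "sin (t * a)"]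
          abs_sin_le_one[of "t * b"] abs_sin_le_one[of "t * a"] elim
        by (intro divide_right_mono) linarith+
      finally show ?case .
    qed
  qed
qed simp

text \<open>By induction on integrable functions it suffices to treat indicators, and by truncation
  indicators of bounded Borel sets. For those, induction over Borel sets reduces the claim to
  intervals, where the integral is explicit.\<close>

theorem riemann_lebesgue_cos:
  fixes f :: "real \<Rightarrow> real"
  assumes "integrable lborel f"
  shows "((\<lambda>t. LBINT x. f x * cos (t * x)) \<longlongrightarrow> 0) at_top"
  using assms
proof (induction rule: integrable_induct)
  case (base A c)
  have bounded_part: "((\<lambda>t. LBINT x. indicator (B \<inter> {-real n..real n}) x * cos (t * x)) \<longlongrightarrow> 0) at_top"
    if "B \<in> sets borel" for B and n :: nat
  proof -
    let ?I = "{-real n..real n}"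
    have int[simp]: "integrable lborel (indicator (C \<inter> ?I) :: real \<Rightarrow> real)" if "C \<in> sets borel" for C
    proof (intro integrable_real_indicator)
      have "emeasure lborel (C \<inter> ?I) \<le> emeasure lborel ?I" by (intro emeasure_mono) auto
      also have "\<dots> < \<infinity>" by simp
      finally show "emeasure lborel (C \<inter> ?I) < \<infinity>" .
    qed (use that in auto)
    have "Int_stable (range (\<lambda>a::real. {..a}))"
      by (auto simp: Int_stable_def)
    moreover have "range (\<lambda>a::real. {..a}) \<subseteq> Pow UNIV"
      by simp
    moreover have "B \<in> sigma_sets UNIV (range (\<lambda>a::real. {..a}))"
      using that by (simp add: borel_eq_atMost sets_measure_of)
    ultimately show ?thesis
    proof (induction rule: sigma_sets_induct_disjoint)
      case (basic C)
      then obtain a where "C = {..a}" by auto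
      then have "C \<inter> ?I = {-real n..min a (real n)}" by auto
      then show ?case by (simp only: integral_interval_cos_tendsto_0)
    next
      case empty
      then show ?case by simp
    next
      case (compl C)
      then have C: "C \<in> sets borel" by (simp add: borel_eq_atMost sets_measure_of)
      have "(indicator ((UNIV - C) \<inter> ?I) x :: real) = indicator ?I x - indicator (C \<inter> ?I) x" for x
        by (simp split: split_indicator)
      moreover have "integrable lborel (\<lambda>x. indicator ?I x * cos (t * x) :: real)" for t
        using integrable_mult_cos[OF int, of UNIV t] by simp
      ultimately have "(LBINT x. indicator ((UNIV - C) \<inter> ?I) x * cos (t * x)) =
          (LBINT x. indicator ?I x * cos (t * x)) - (LBINT x. indicator (C \<inter> ?I) x * cos (t * x))" for t
        by (simp add: left_diff_distrib integrable_mult_cos C)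
      then show ?case
        using tendsto_diff[OF integral_interval_cos_tendsto_0[of "-real n" "real n"] compl.IH] by simp
    next
      case (union C)
      then have C: "C i \<in> sets borel" for i by (auto simp: borel_eq_atMost sets_measure_of)
      have sums: "(\<lambda>i. indicator (C i \<inter> ?I) x) sums (indicator ((\<Union>i. C i) \<inter> ?I) x :: real)" for x
        using indicator_sums[of "\<lambda>i. C i \<inter> ?I" x] union.hyps(1)
        by (auto simp: disjoint_family_on_def)
      have le: "(\<Sum>i<k. indicator (C i \<inter> ?I) x) \<le> (indicator ((\<Union>i. C i) \<inter> ?I) x :: real)" for k x
        using sum_le_suminf[OF sums_summable[OF sums[of x]], of "{..<k}"] sums_unique[OF sums[of x]]
        by simp
      show ?case
      proof (rule tendsto_integral_cos_of_L1_limit)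
        fix k
        show "integrable lborel (\<lambda>x. \<Sum>i<k. indicator (C i \<inter> ?I) x :: real)"
          using C by auto
        show "((\<lambda>t. LBINT x. (\<Sum>i<k. indicator (C i \<inter> ?I) x) * cos (t * x)) \<longlongrightarrow> 0) at_top"
          unfolding sum_distrib_right using C
          by (subst Bochner_Integration.integral_sum)
             (auto simp only: integrable_mult_cos int intro!: tendsto_null_sum union.IH)
        fix x
        show "\<bar>\<Sum>i<k. indicator (C i \<inter> ?I) x\<bar> \<le> 2 * \<bar>indicator ((\<Union>i. C i) \<inter> ?I) x :: real\<bar>"
          using le[where k = k and x = x]
          by (simp add: sum_nonneg) (erule order_trans, simp split: split_indicator)
      next
        show "integrable lborel (indicator ((\<Union>i. C i) \<inter> ?I) :: real \<Rightarrow> real)"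
          using C by auto
        show "(\<lambda>k. \<Sum>i<k. indicator (C i \<inter> ?I) x) \<longlonglongrightarrow> (indicator ((\<Union>i. C i) \<inter> ?I) x :: real)" for x
          using sums by (simp add: sums_def)
      qed
    qed
  qed
  have "((\<lambda>t. LBINT x. indicator A x * cos (t * x)) \<longlongrightarrow> 0) at_top"
  proof (rule tendsto_integral_cos_of_L1_limit)
    show "integrable lborel (indicator A :: real \<Rightarrow> real)"
      using base by auto
    show "integrable lborel (indicator (A \<inter> {-real n..real n}) :: real \<Rightarrow> real)" for n
    proof (intro integrable_real_indicator)
      have "emeasure lborel (A \<inter> {-real n..real n}) \<le> emeasure lborel A"
        using base by (intro emeasure_mono) auto
      also have "\<dots> < \<infinity>" using base by simp
      finally show "emeasure lborel (A \<inter> {-real n..real n}) < \<infinity>" .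
    qed (use base in auto)
    show "((\<lambda>t. LBINT x. indicator (A \<inter> {-real n..real n}) x * cos (t * x)) \<longlongrightarrow> 0) at_top" for n
      using base bounded_part by simp
    show "\<bar>indicator (A \<inter> {-real n..real n}) x\<bar> \<le> 2 * \<bar>indicator A x :: real\<bar>" for n x
      by (simp split: split_indicator)
    fix x :: real
    obtain N :: nat where N: "\<bar>x\<bar> \<le> real N" using real_arch_simple by blast
    have "eventually (\<lambda>n. indicator A x = (indicator (A \<inter> {-real n..real n}) x :: real)) sequentially"
      using eventually_ge_at_top[of N] by eventually_elim (use N in \<open>auto split: split_indicator\<close>)
    then show "(\<lambda>n. indicator (A \<inter> {-real n..real n}) x) \<longlonglongrightarrow> (indicator A x :: real)"
      by (rule Lim_transform_eventually[OF tendsto_const])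
  qed
  from tendsto_mult_left[OF this, of c] show ?case
    by (simp add: mult.assoc mult.left_commute flip: integral_mult_right_zero)
next
  case (add f g)
  show ?case
    using tendsto_add[OF add.IH] add.hyps by (simp add: distrib_right integrable_mult_cos)
next
  case (lim f s)
  then show ?case
    by (intro tendsto_integral_cos_of_L1_limit[of f s]) auto
qed

section \<open>Characteristic functions\<close>

lemma (in real_distribution) char_distr_shift:
  "char (distr M borel (\<lambda>z. z + a)) t = iexp (t * a) * char M t"
proof -
  have "char (distr M borel (\<lambda>z. z + a)) t = (CLINT x|M. iexp (t * a) * iexp (t * x))"
    by (simp add: char_def integral_distr ring_distribs exp_add mult.commute)
  then show ?thesis
    by (simp add: char_def)
qed

lemma has_vector_derivative_iff_difference_quotient:
  fixes f :: "real \<Rightarrow> complex"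
  shows "(f has_vector_derivative D) (at t) \<longleftrightarrow>
    ((\<lambda>h. (f (t + h) - f t) / of_real h - D) \<longlongrightarrow> 0) (at 0)"
proof -
  have "norm (f (t + h) - f t - h *\<^sub>R D) / norm h = norm ((f (t + h) - f t) / of_real h - D)"
    if "h \<noteq> 0" for h
  proof -
    have "(f (t + h) - f t) / of_real h - D = (f (t + h) - f t - h *\<^sub>R D) / of_real h"
      using that by (simp add: field_simps scaleR_conv_of_real)
    then show ?thesis
      by (simp add: norm_divide)
  qed
  then have "((\<lambda>h. norm (f (t + h) - f t - h *\<^sub>R D) / norm h) \<longlongrightarrow> 0) (at 0) \<longleftrightarrow>
      ((\<lambda>h. norm ((f (t + h) - f t) / of_real h - D)) \<longlongrightarrow> 0) (at 0)"
    by (intro filterlim_cong) (auto simp: eventually_at_filter)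
  then show ?thesis
    by (simp add: has_vector_derivative_def has_derivative_at bounded_linear_scaleR_left tendsto_norm_zero_iff)
qed

text \<open>Differentiation under the integral sign: \<open>\<bar>exp (\<i> h x) - 1\<bar> \<le> \<bar>h x\<bar>\<close> bounds the difference
  quotients of the integrand by \<open>\<bar>x\<bar>\<close>, so that dominated convergence applies.\<close>

lemma (in real_distribution) has_vector_derivative_char:
  assumes "integrable M (\<lambda>x. x)"
  shows "(char M has_vector_derivative (CLINT x|M. \<i> * x * iexp (t * x))) (at t)"
proof -
  have [simp]: "integrable M (\<lambda>x. \<i> * x * iexp (u * x))" for u
    using assms by (intro Bochner_Integration.integrable_bound[OF assms]) (auto simp: norm_mult)
  let ?q = "\<lambda>h x. (iexp ((t + h) * x) - iexp (t * x)) / of_real h - \<i> * x * iexp (t * x)"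
  have "((\<lambda>h. CLINT x|M. ?q h x) \<longlongrightarrow> 0) (at 0)"
    unfolding tendsto_at_iff_sequentially
  proof safe
    fix X :: "nat \<Rightarrow> real" assume nz: "\<forall>i. X i \<in> UNIV - {0}" and X: "X \<longlonglongrightarrow> 0"
    have "(\<lambda>i. CLINT x|M. ?q (X i) x) \<longlonglongrightarrow> (CLINT x|M. 0)"
    proof (rule integral_dominated_convergence[where w="\<lambda>x. 2 * \<bar>x\<bar>"])
      show "AE x in M. (\<lambda>i. ?q (X i) x) \<longlonglongrightarrow> 0"
      proof (intro AE_I2)
        fix x :: real
        have "((\<lambda>u. iexp (u * x)) has_vector_derivative \<i> * x * iexp (t * x)) (at t)"
          by (auto intro!: derivative_eq_intros simp: has_vector_derivative_complex_iff Re_exp Im_exp)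
        then have "((\<lambda>h. ?q h x) \<longlongrightarrow> 0) (at 0)"
          by (simp only: has_vector_derivative_iff_difference_quotient)
        with nz X show "(\<lambda>i. ?q (X i) x) \<longlonglongrightarrow> 0"
          by (auto simp: tendsto_at_iff_sequentially comp_def)
      qed
      show "AE x in M. norm (?q (X i) x) \<le> 2 * \<bar>x\<bar>" for i
      proof (intro AE_I2)
        fix x :: real
        have "iexp ((t + X i) * x) - iexp (t * x) = iexp (t * x) * (iexp (X i * x) - 1)"
          by (simp add: ring_distribs exp_add)
        then have "norm (iexp ((t + X i) * x) - iexp (t * x)) \<le> \<bar>X i\<bar> * \<bar>x\<bar>"
          using iexp_approx1[of "X i * x" 0] by (simp add: norm_mult abs_mult)
        then have "norm ((iexp ((t + X i) * x) - iexp (t * x)) / X i) \<le> \<bar>x\<bar>"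
          using nz[rule_format, of i] by (simp add: norm_divide field_simps)
        then show "norm (?q (X i) x) \<le> 2 * \<bar>x\<bar>"
          using norm_triangle_ineq4[of "(iexp ((t + X i) * x) - iexp (t * x)) / X i" "\<i> * x * iexp (t * x)"]
          by (simp add: norm_mult)
      qed
    qed (use assms in auto)
    then show "((\<lambda>h. CLINT x|M. ?q h x) \<circ> X) \<longlonglongrightarrow> 0"
      by (simp add: comp_def)
  qed
  moreover have "(CLINT x|M. ?q h x) = (char M (t + h) - char M t) / of_real h - (CLINT x|M. \<i> * x * iexp (t * x))" for h
  proof -
    have "integrable M (\<lambda>x. iexp (u * x))" for u
      by (intro integrable_iexp) auto
    then show ?thesis
      by (simp add: char_def del: of_real_mult of_real_add)
  qed
  ultimately show ?thesis
    by (simp add: has_vector_derivative_iff_difference_quotient)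
qed

lemma (in real_distribution) isCont_char_derivative:
  assumes "integrable M (\<lambda>x. x)"
  shows "isCont (\<lambda>t. CLINT x|M. \<i> * x * iexp (t * x)) t"
  unfolding continuous_at_sequentially
proof safe
  fix X assume X: "X \<longlonglongrightarrow> t"
  show "((\<lambda>t. CLINT x|M. \<i> * x * iexp (t * x)) \<circ> X) \<longlonglongrightarrow> (CLINT x|M. \<i> * x * iexp (t * x))"
    unfolding comp_def
    using assms
    by (intro integral_dominated_convergence[where w="\<lambda>x. \<bar>x\<bar>"])
       (auto intro!: tendsto_intros X simp: norm_mult)
qed

section \<open>Exchange of integrals under a product bound\<close>

lemma set_integral_swap_dominated:
  fixes g :: "'a \<Rightarrow> real \<Rightarrow> real" and w :: "'a \<Rightarrow> real" and v :: "real \<Rightarrow> real"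
  assumes P: "sigma_finite_measure P"
    and meas: "(\<lambda>(x, s). indicator A s * g x s) \<in> borel_measurable (P \<Otimes>\<^sub>M lborel)"
    and w: "integrable P w" and v: "set_integrable lborel A v"
    and bound: "\<And>x s. s \<in> A \<Longrightarrow> \<bar>g x s\<bar> \<le> w x * v s"
  shows "integrable P (\<lambda>x. LBINT s:A. g x s)"
    and "(LINT x|P. (LBINT s:A. g x s)) = (LBINT s:A. (LINT x|P. g x s))"
proof -
  interpret P: sigma_finite_measure P by fact
  interpret pair_sigma_finite P lborel ..
  let ?v = "\<lambda>s. indicator A s * v s"
  have v': "integrable lborel ?v" using v by (simp add: set_integrable_def)
  have [measurable]: "w \<in> borel_measurable P" "?v \<in> borel_measurable lborel"
    using w v' by auto
  have prod: "integrable (P \<Otimes>\<^sub>M lborel) (\<lambda>(x, s). w x * ?v s)"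
  proof (rule Fubini_integrable)
    show "integrable P (\<lambda>x. LBINT s. norm (case (x, s) of (x, s) \<Rightarrow> w x * ?v s))"
      using w by (simp add: abs_mult[of "w _"])
    show "AE x in P. integrable lborel (\<lambda>s. case (x, s) of (x, s) \<Rightarrow> w x * ?v s)"
      using v' by simp
  qed measurable
  have int: "integrable (P \<Otimes>\<^sub>M lborel) (\<lambda>(x, s). indicator A s * g x s)"
    by (rule Bochner_Integration.integrable_bound[OF prod meas])
       (auto split: split_indicator intro!: AE_I2 intro: order_trans[OF bound abs_ge_self])
  show "integrable P (\<lambda>x. LBINT s:A. g x s)"
    using integrable_fst'[OF int] by (simp add: set_lebesgue_integral_def)
  show "(LINT x|P. (LBINT s:A. g x s)) = (LBINT s:A. (LINT x|P. g x s))"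
    using Fubini_integral[OF int] by (simp add: set_lebesgue_integral_def)
qed

section \<open>The sine integral and the limit of the weight transform\<close>

text \<open>No sign condition on \<open>t\<close>: the interval integral on the right is oriented.\<close>

lemma sine_integral_rescale:
  "(LBINT y:{0..1}. sin (t * y * \<mu>) / y) = (LBINT y=0..t. sin (\<mu> * y) / y)" for t \<mu> :: real
proof (cases "t = 0")
  case False
  have "(LBINT y:{0..1}. sin (t * y * \<mu>) / y) = (LBINT y=ereal 0..ereal 1. sin (t * y * \<mu>) / y)"
    by (simp add: interval_integral_Icc)
  \<comment> \<open>Substitution requires a continuous integrand, so the value at \<open>0\<close> is changed first.\<close>
  also have "\<dots> = (LBINT y=ereal 0..ereal 1. t *\<^sub>R (\<mu> * sinc (\<mu> * (t * y))))"
    using False by (intro interval_integral_discrete_difference[where X = "{0}"]) (auto simp: mult_ac)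
  also have "\<dots> = (LBINT y=ereal (t * 0)..ereal (t * 1). \<mu> * sinc (\<mu> * y))"
  proof (rule interval_integral_substitution_finite)
    show "continuous_on ((*) t ` {0..1}) (\<lambda>y. \<mu> * sinc (\<mu> * y))"
      by (intro continuous_on_mult continuous_on_sinc continuous_on_const continuous_on_id)
  qed (auto intro!: derivative_eq_intros)
  also have "\<dots> = (LBINT y=ereal (t * 0)..ereal (t * 1). sin (\<mu> * y) / y)"
    by (intro interval_integral_discrete_difference[where X = "{0}"]) auto
  finally show ?thesis by (simp add: zero_ereal_def)
qed (simp add: zero_ereal_def)

lemma sine_integral_limit:
  "((\<lambda>t::real. 1 / pi * (LBINT y=0..t. sin (\<mu> * y) / y)) \<longlongrightarrow> sgn \<mu> / 2) at_top" for \<mu> :: real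
proof -
  have "((\<lambda>t. 1 / pi * (sgn \<mu> * Si (t * \<bar>\<mu>\<bar>))) \<longlongrightarrow> sgn \<mu> / 2) at_top"
  proof (cases "\<mu> = 0")
    case False
    have "((\<lambda>t. Si (t * \<bar>\<mu>\<bar>)) \<longlongrightarrow> pi / 2) at_top"
      using False
      by (intro filterlim_compose[OF Si_at_top] filterlim_at_top_mult_tendsto_pos[OF tendsto_const]
          filterlim_ident) auto
    then have "((\<lambda>t. 1 / pi * (sgn \<mu> * Si (t * \<bar>\<mu>\<bar>))) \<longlongrightarrow> 1 / pi * (sgn \<mu> * (pi / 2))) at_top"
      by (intro tendsto_intros)
    then show ?thesis by simp
  qed simp
  moreover have "eventually (\<lambda>t. 1 / pi * (sgn \<mu> * Si (t * \<bar>\<mu>\<bar>)) =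
      1 / pi * (LBINT y=0..t. sin (\<mu> * y) / y)) at_top"
    using eventually_ge_at_top[of 0]
    by eventually_elim (simp add: LBINT_I0c_sin_scale_divide mult.commute[of \<mu>])
  ultimately show ?thesis
    by (rule Lim_transform_eventually)
qed

lemma admissible_weight_limit:
  assumes "admissible_weight \<omega>"
  shows "((\<lambda>t. LBINT s:{-1..1}. \<omega> s * cos (t * s * \<mu>)) \<longlongrightarrow> (if \<mu> = 0 then 1 else 0)) at_top"
proof (cases "\<mu> = 0")
  case True
  then show ?thesis using assms by (simp add: admissible_weight_def)
next
  case False
  have "integrable lborel (\<lambda>s. indicator {-1..1} s * \<omega> s)"
    using assms by (simp add: admissible_weight_def set_integrable_def)
  note lim = riemann_lebesgue_cos[OF this]
  have "filterlim (\<lambda>t. t * \<bar>\<mu>\<bar>) at_top at_top"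
    using False by (intro filterlim_at_top_mult_tendsto_pos[OF tendsto_const] filterlim_ident) auto
  from filterlim_compose[OF lim this]
  have "((\<lambda>t. LBINT s. indicator {-1..1} s * \<omega> s * cos (t * \<bar>\<mu>\<bar> * s)) \<longlongrightarrow> 0) at_top" .
  moreover have "cos (t * \<bar>\<mu>\<bar> * s) = cos (t * s * \<mu>)" for t s
    by (cases "\<mu> \<ge> 0") (simp_all add: mult_ac)
  ultimately show ?thesis
    using False by (simp add: set_lebesgue_integral_def mult.assoc)
qed

section \<open>Type I families with a first moment\<close>

text \<open>A Type I location-shift family with a first moment. The moment is required at index \<open>0\<close>
  only, since the other laws are translates of that one.\<close>

locale integrable_type_I_family =
  fixes U :: "real set" and F :: "real \<Rightarrow> real \<Rightarrow> real"
  assumes family: "type_I_location_shift_family U F"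
    and first_moment: "integrable (law F 0) (\<lambda>x. x)"
begin

subsection \<open>The laws and their characteristic functions\<close>

lemma real_distribution_law:
  assumes "\<mu> \<in> U"
  shows "real_distribution (law F \<mu>)"
  using assms family
  by (intro real_distribution_interval_measure)
     (auto simp: type_I_location_shift_family_def location_shift_family_def cdf_family_def is_cdf_def
       intro: monoD)

lemma cdf_law:
  assumes "\<mu> \<in> U"
  shows "cdf (law F \<mu>) = F \<mu>"
  using assms family
  by (intro cdf_interval_measure)
     (auto simp: type_I_location_shift_family_def location_shift_family_def cdf_family_def is_cdf_def
       intro: monoD)

lemma zero_in: "0 \<in> U"
  using family by (simp add: type_I_location_shift_family_def)

sublocale law0: real_distribution "law F 0"
  by (rule real_distribution_law[OF zero_in])

lemma law_eq_shift:
  assumes "\<mu> \<in> U"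
  shows "law F \<mu> = distr (law F 0) borel (\<lambda>z. z + \<mu>)"
proof (rule cdf_unique)
  show "cdf (law F \<mu>) = cdf (distr (law F 0) borel (\<lambda>z. z + \<mu>))"
    using family assms zero_in cdf_law[OF assms] cdf_law[OF zero_in] law0.real_distribution_axioms
    by (simp add: type_I_location_shift_family_def location_shift_family_def)
qed (auto intro: real_distribution_law assms)

lemma integrable_law:
  assumes "\<mu> \<in> U"
  shows "integrable (law F \<mu>) (\<lambda>x. x)"
proof -
  have "integrable (law F 0) (\<lambda>x. x + \<mu>)"
    by (intro Bochner_Integration.integrable_add first_moment law0.integrable_const)
  then have "integrable (distr (law F 0) borel (\<lambda>z. z + \<mu>)) (\<lambda>x. x)"
    by (simp add: integrable_distr_eq)
  then show ?thesis
    by (simp only: law_eq_shift[OF assms])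
qed

lemma r_pos: "r F 0 t > 0"
  using family by (auto simp: type_I_location_shift_family_def r_def)

lemma char_law0: "char (law F 0) t = of_real (r F 0 t)"
  using family by (simp add: type_I_location_shift_family_def Fhat_def)

lemma r_even: "r F 0 (- t) = r F 0 t"
proof -
  have "char (law F 0) (- t) = (CLINT x|law F 0. cnj (iexp (t * x)))"
    by (simp add: char_def exp_cnj)
  also have "\<dots> = cnj (char (law F 0) t)"
    by (simp only: char_def Bochner_Integration.integral_cnj)
  finally have "char (law F 0) (- t) = cnj (char (law F 0) t)" .
  then show ?thesis by (simp add: r_def Fhat_def)
qed

lemma char_law:
  assumes "\<mu> \<in> U"
  shows "char (law F \<mu>) t = iexp (t * \<mu>) * of_real (r F 0 t)"
  using law0.char_distr_shift[of \<mu> t] by (simp add: law_eq_shift[OF assms] char_law0)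

lemma
  assumes "\<mu> \<in> U"
  shows integral_cos_law: "(LINT x|law F \<mu>. cos (t * x)) = cos (t * \<mu>) * r F 0 t"
    and integral_sin_law: "(LINT x|law F \<mu>. sin (t * x)) = sin (t * \<mu>) * r F 0 t"
proof -
  interpret real_distribution "law F \<mu>" by (rule real_distribution_law[OF assms])
  have int: "integrable (law F \<mu>) (\<lambda>x. iexp (t * x))" by (intro integrable_iexp) auto
  have "(LINT x|law F \<mu>. cos (t * x)) = Re (char (law F \<mu>) t)"
    "(LINT x|law F \<mu>. sin (t * x)) = Im (char (law F \<mu>) t)"
    unfolding char_def using integral_Re[OF int] integral_Im[OF int] by (simp_all add: Re_exp Im_exp)
  then show "(LINT x|law F \<mu>. cos (t * x)) = cos (t * \<mu>) * r F 0 t"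
    "(LINT x|law F \<mu>. sin (t * x)) = sin (t * \<mu>) * r F 0 t"
    by (simp_all add: char_law[OF assms] Re_exp Im_exp)
qed

text \<open>The derivative of \<open>r F 0\<close>. The real part only converts the type, since the characteristic
  function of the law of index \<open>0\<close> is real, and so is its derivative.\<close>

definition r' :: "real \<Rightarrow> real" where
  "r' t = Re (CLINT x|law F 0. \<i> * x * iexp (t * x))"

lemma DERIV_r: "(r F 0 has_real_derivative r' t) (at t)"
proof -
  have "((\<lambda>t. Re (char (law F 0) t)) has_vector_derivative r' t) (at t)"
    unfolding r'_def
    by (intro bounded_linear.has_vector_derivative[OF bounded_linear_Re]
        law0.has_vector_derivative_char first_moment)
  then show ?thesis
    by (simp add: char_law0 has_real_derivative_iff_has_vector_derivative)
qed

lemma continuous_on_r': "continuous_on A r'"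
  using law0.isCont_char_derivative[OF first_moment] unfolding r'_def[abs_def]
  by (intro continuous_on_Re continuous_at_imp_continuous_on) auto

lemma continuous_on_r: "continuous_on A (r F 0)"
  using DERIV_r by (intro continuous_at_imp_continuous_on) (auto intro: DERIV_isCont)

lemma continuous_on_r'_compose [continuous_intros]:
  "continuous_on A f \<Longrightarrow> continuous_on A (\<lambda>x. r' (f x))"
  by (rule continuous_on_compose2[OF continuous_on_r'[of UNIV]]) auto

lemma continuous_on_r_compose [continuous_intros]:
  "continuous_on A f \<Longrightarrow> continuous_on A (\<lambda>x. r F 0 (f x))"
  by (rule continuous_on_compose2[OF continuous_on_r[of UNIV]]) auto

lemma borel_measurable_r [measurable]: "r F 0 \<in> borel_measurable borel"
  by (intro borel_measurable_continuous_onI continuous_on_r)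

lemma r_neq_0 [simp]: "r F 0 t \<noteq> 0"
  using r_pos[of t] by simp

lemma deriv_inverse_r:
  "((\<lambda>s. 1 / r F 0 (a * s)) has_real_derivative - (a * r' (a * s)) / (r F 0 (a * s))\<^sup>2) (at s)"
  by (auto intro!: derivative_eq_intros DERIV_chain2[where f = "r F 0", OF DERIV_r]
      simp: power2_eq_square)

subsection \<open>The kernels as single integrals\<close>

lemma has_vector_derivative_kernel:
  "((\<lambda>s. iexp (t * y * s * x) / of_real (r F 0 (t * y * s))) has_vector_derivative
     (iexp (t * y * s * x) * of_real (- (t * y * r' (t * y * s)) / (r F 0 (t * y * s))\<^sup>2)
      + \<i> * of_real (t * y * x) * iexp (t * y * s * x) / of_real (r F 0 (t * y * s)))) (at s)"
proof -
  have 1: "((\<lambda>s. iexp (t * y * s * x)) has_vector_derivative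
      \<i> * of_real (t * y * x) * iexp (t * y * s * x)) (at s)"
    by (auto intro!: derivative_eq_intros simp: has_vector_derivative_complex_iff Re_exp Im_exp)
  have 2: "((\<lambda>s. complex_of_real (1 / r F 0 (t * y * s))) has_vector_derivative
      of_real (- (t * y * r' (t * y * s)) / (r F 0 (t * y * s))\<^sup>2)) (at s)"
    using deriv_inverse_r[of "t * y" s, unfolded has_real_derivative_iff_has_vector_derivative]
    by (rule bounded_linear.has_vector_derivative[OF bounded_linear_of_real])
  show ?thesis
    using has_vector_derivative_mult[OF 1 2] by (simp add: divide_inverse add.commute)
qed

lemma K1_dagger_integrand_eq:
  assumes "y \<noteq> 0"
  shows "K1_dagger_integrand F t x y s =
    of_real (t * x) * iexp (t * y * s * x) / of_real (r F 0 (t * y * s))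
    - iexp (t * y * s * x) * of_real (deriv (\<lambda>s. 1 / r F 0 (t * y * s)) s / y) * \<i>"
  unfolding K1_dagger_integrand_def
    vector_derivative_at[OF has_vector_derivative_kernel] DERIV_imp_deriv[OF deriv_inverse_r]
  using assms by (simp add: field_simps)

lemma K1_integrand_eq_Re:
  assumes "y \<noteq> 0"
  shows "K1_integrand F t x y s = Re (K1_dagger_integrand F t x y s)"
  unfolding K1_dagger_integrand_eq[OF assms] K1_integrand_def
  by (simp add: Re_exp Im_exp mult_ac)

lemma
  assumes "y \<noteq> 0"
  shows set_integrable_K1_dagger_integrand:
      "set_integrable lborel {-1..1} (K1_dagger_integrand F t x y)"
    and inner_integral_K1_dagger_integrand:
      "(LBINT s:{-1..1}. K1_dagger_integrand F t x y s) =
         of_real (2 * (sin (t * y * x) / (y * r F 0 (t * y))))"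
proof -
  let ?k = "\<lambda>s. iexp (t * y * s * x) / of_real (r F 0 (t * y * s))"
  have cont: "continuous_on {-1..1} (K1_dagger_integrand F t x y)"
    unfolding K1_dagger_integrand_def vector_derivative_at[OF has_vector_derivative_kernel]
    using assms by (auto intro!: continuous_intros)
  then show "set_integrable lborel {-1..1} (K1_dagger_integrand F t x y)"
    by (rule borel_integrable_atLeastAtMost')
  have "((\<lambda>s. 1 / (\<i> * of_real y) * ?k s) has_vector_derivative K1_dagger_integrand F t x y s)
      (at s within {-1..1})" for s
    unfolding K1_dagger_integrand_def vector_derivative_at[OF has_vector_derivative_kernel]
    by (rule has_vector_derivative_mult_right[OF has_vector_derivative_at_within[OF
          has_vector_derivative_kernel]])
  then have "(LBINT s:{-1..1}. K1_dagger_integrand F t x y s) =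
      1 / (\<i> * of_real y) * ?k 1 - 1 / (\<i> * of_real y) * ?k (-1)"
    unfolding set_lebesgue_integral_def using cont by (intro integral_FTC_Icc) auto
  also have "\<dots> = 1 / (\<i> * of_real y) * ((iexp (t * y * x) - iexp (- (t * y * x))) / of_real (r F 0 (t * y)))"
    by (simp add: r_even diff_divide_distrib right_diff_distrib)
  also have "iexp (t * y * x) - iexp (- (t * y * x)) = 2 * \<i> * of_real (sin (t * y * x))"
    by (simp add: complex_eq_iff Re_exp Im_exp)
  finally show "(LBINT s:{-1..1}. K1_dagger_integrand F t x y s) =
      of_real (2 * (sin (t * y * x) / (y * r F 0 (t * y))))"
    using assms by (simp add: field_simps)
qed

lemma r_bounded_below:
  obtains m where "m > 0" "\<And>u. u \<in> {a..b} \<Longrightarrow> m \<le> r F 0 u"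
proof (cases "{a..b} = {}")
  case False
  then obtain u where "u \<in> {a..b}" "\<forall>v\<in>{a..b}. r F 0 u \<le> r F 0 v"
    using continuous_attains_inf[OF compact_Icc _ continuous_on_r] by blast
  then show ?thesis using that[of "r F 0 u"] r_pos by auto
qed (use that[of 1] in auto)

text \<open>The single integral to which \<open>\<pi> * K1_dagger\<close> reduces.\<close>

definition sine_kernel :: "real \<Rightarrow> real \<Rightarrow> real" where
  "sine_kernel t x = (LBINT y:{0..1}. sin (t * y * x) / (y * r F 0 (t * y)))"

lemma set_integrable_inverse_r:
  "set_integrable lborel {a..b} (\<lambda>y. c / r F 0 (t * y))"
  by (intro borel_integrable_atLeastAtMost') (auto intro!: continuous_intros)

text \<open>At \<open>y = 0\<close> the left-hand side is \<open>0\<close> because division by zero yields zero.\<close>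

lemma abs_sine_kernel_integrand_le:
  assumes "0 \<le> y"
  shows "\<bar>sin (t * y * x) / (y * r F 0 (t * y))\<bar> \<le> \<bar>x\<bar> * (\<bar>t\<bar> / r F 0 (t * y))"
proof (cases "y = 0")
  case False
  have "\<bar>sin (t * y * x) / (y * r F 0 (t * y))\<bar> = \<bar>sin (t * y * x)\<bar> / (y * r F 0 (t * y))"
    using assms r_pos[of "t * y"] by (simp add: abs_mult)
  also have "\<dots> \<le> (\<bar>t\<bar> * y * \<bar>x\<bar>) / (y * r F 0 (t * y))"
    using abs_sin_x_le_abs_x[of "t * y * x"] assms r_pos[of "t * y"]
    by (intro divide_right_mono) (simp_all add: abs_mult)
  finally show ?thesis using False by (simp add: mult.commute)
qed (use r_pos[of 0] in simp)

lemma set_integrable_sine_kernel: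
  "set_integrable lborel {0..1} (\<lambda>y. sin (t * y * x) / (y * r F 0 (t * y)))"
  unfolding set_integrable_def
proof (rule Bochner_Integration.integrable_bound)
  show "integrable lborel (\<lambda>y. indicator {0..1} y *\<^sub>R (\<bar>x\<bar> * \<bar>t\<bar> / r F 0 (t * y)))"
    using set_integrable_inverse_r[of 0 1 "\<bar>x\<bar> * \<bar>t\<bar>" t] by (simp add: set_integrable_def)
  show "AE y in lborel. norm (indicator {0..1} y *\<^sub>R (sin (t * y * x) / (y * r F 0 (t * y))))
      \<le> norm (indicator {0..1} y *\<^sub>R (\<bar>x\<bar> * \<bar>t\<bar> / r F 0 (t * y)))"
    using abs_sine_kernel_integrand_le[of _ t x] r_pos
    by (intro AE_I2) (auto split: split_indicator simp: abs_of_pos[OF r_pos])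
qed measurable

lemma
  shows iterated_integrable_K1_dagger:
      "iterated_integrable {0..1} {-1..1} (K1_dagger_integrand F t x)"
    and K1_dagger_eq: "K1_dagger F t x = of_real (1 / pi * sine_kernel t x)"
proof -
  let ?J = "\<lambda>y. LBINT s:{-1..1}. K1_dagger_integrand F t x y s"
  let ?h = "\<lambda>y. sin (t * y * x) / (y * r F 0 (t * y))"
  have J: "indicator {0..1} y *\<^sub>R ?J y = complex_of_real (2 * (indicator {0..1} y *\<^sub>R ?h y))"
    if "y \<noteq> 0" for y :: real
    using that by (simp add: inner_integral_K1_dagger_integrand scaleR_conv_of_real)
  have "integrable lborel (\<lambda>y. complex_of_real (2 * (indicator {0..1} y *\<^sub>R ?h y)))"
    using set_integrable_sine_kernel[of t x] unfolding set_integrable_def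
    by (intro integrable_of_real integrable_mult_right) simp
  then have "integrable lborel (\<lambda>y. indicator {0..1} y *\<^sub>R ?J y)"
    by (rule integrable_discrete_difference[where X = "{0}", THEN iffD1, rotated 4]) (auto simp: J)
  then show "iterated_integrable {0..1} {-1..1} (K1_dagger_integrand F t x)"
    unfolding iterated_integrable_def set_integrable_def[of _ "{0..1}"]
    using AE_lborel_singleton[of 0] set_integrable_K1_dagger_integrand[of _ t x]
    by (auto elim!: eventually_mono)
  have "(LBINT y:{0..1}. ?J y) = (LBINT y. complex_of_real (2 * (indicator {0..1} y *\<^sub>R ?h y)))"
    unfolding set_lebesgue_integral_def[of _ "{0..1}"]
    by (rule integral_discrete_difference[where X = "{0}"]) (auto simp: J)
  also have "\<dots> = complex_of_real (2 * sine_kernel t x)"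
    unfolding integral_complex_of_real integral_mult_right_zero
    by (simp add: sine_kernel_def set_lebesgue_integral_def)
  finally show "K1_dagger F t x = of_real (1 / pi * sine_kernel t x)"
    by (simp add: K1_dagger_def iterated_integral_def)
qed

lemma
  shows iterated_integrable_K1:
      "iterated_integrable {0..1} {-1..1} (K1_integrand F t x)"
    and iterated_integral_K1:
      "iterated_integral {0..1} {-1..1} (K1_integrand F t x) = 2 * sine_kernel t x"
proof -
  let ?J = "\<lambda>y. LBINT s:{-1..1}. K1_integrand F t x y s"
  let ?h = "\<lambda>y. sin (t * y * x) / (y * r F 0 (t * y))"
  have inner: "set_integrable lborel {-1..1} (K1_integrand F t x y)" "?J y = 2 * ?h y"
    if "y \<noteq> 0" for y
  proof -
    have "K1_integrand F t x y = (\<lambda>s. Re (K1_dagger_integrand F t x y s))"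
      using that by (simp add: fun_eq_iff K1_integrand_eq_Re)
    then show "set_integrable lborel {-1..1} (K1_integrand F t x y)" "?J y = 2 * ?h y"
      using integrable_Re[OF set_integrable_K1_dagger_integrand[OF that, of t x, unfolded set_integrable_def]]
        integral_Re[OF set_integrable_K1_dagger_integrand[OF that, of t x, unfolded set_integrable_def]]
        inner_integral_K1_dagger_integrand[OF that, of t x]
      by (simp_all add: set_integrable_def set_lebesgue_integral_def)
  qed
  have J: "indicator {0..1} y *\<^sub>R ?J y = 2 * (indicator {0..1} y *\<^sub>R ?h y)"
    if "y \<noteq> 0" for y :: real
    using that by (simp add: inner)
  have "integrable lborel (\<lambda>y. 2 * (indicator {0..1} y *\<^sub>R ?h y))"
    using set_integrable_sine_kernel[of t x] unfolding set_integrable_def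
    by (intro integrable_mult_right) simp
  then have "integrable lborel (\<lambda>y. indicator {0..1} y *\<^sub>R ?J y)"
    by (rule integrable_discrete_difference[where X = "{0}", THEN iffD1, rotated 4])
       (auto simp: J simp del: real_scaleR_def)
  then show "iterated_integrable {0..1} {-1..1} (K1_integrand F t x)"
    unfolding iterated_integrable_def set_integrable_def[of _ "{0..1}"]
    using AE_lborel_singleton[of 0] inner(1)
    by (auto elim!: eventually_mono)
  have "(LBINT y:{0..1}. ?J y) = (LBINT y. 2 * (indicator {0..1} y *\<^sub>R ?h y))"
    unfolding set_lebesgue_integral_def[of _ "{0..1}"]
    by (rule integral_discrete_difference[where X = "{0}"]) (auto simp: J simp del: real_scaleR_def)
  also have "\<dots> = 2 * sine_kernel t x"
    unfolding integral_mult_right_zero by (simp add: sine_kernel_def set_lebesgue_integral_def)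
  finally show "iterated_integral {0..1} {-1..1} (K1_integrand F t x) = 2 * sine_kernel t x"
    by (simp add: iterated_integral_def)
qed

subsection \<open>Means of the kernels\<close>

lemma
  assumes "\<mu> \<in> U"
  shows integrable_sine_kernel: "integrable (law F \<mu>) (sine_kernel t)"
    and integral_sine_kernel:
      "(LINT x|law F \<mu>. sine_kernel t x) = (LBINT y:{0..1}. sin (t * y * \<mu>) / y)"
proof -
  interpret real_distribution "law F \<mu>" by (rule real_distribution_law[OF assms])
  have fubini:
    "integrable (law F \<mu>) (\<lambda>x. LBINT y:{0..1}. sin (t * y * x) / (y * r F 0 (t * y)))"
    "(LINT x|law F \<mu>. (LBINT y:{0..1}. sin (t * y * x) / (y * r F 0 (t * y)))) =
      (LBINT y:{0..1}. (LINT x|law F \<mu>. sin (t * y * x) / (y * r F 0 (t * y))))"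
    using abs_sine_kernel_integrand_le
    by (intro set_integral_swap_dominated[where w = "\<lambda>x. \<bar>x\<bar>" and v = "\<lambda>y. \<bar>t\<bar> / r F 0 (t * y)"]
        sigma_finite_measure_axioms integrable_abs integrable_law assms set_integrable_inverse_r; simp)+
  show "integrable (law F \<mu>) (sine_kernel t)"
    using fubini(1) by (simp add: sine_kernel_def[abs_def])
  show "(LINT x|law F \<mu>. sine_kernel t x) = (LBINT y:{0..1}. sin (t * y * \<mu>) / y)"
    unfolding sine_kernel_def fubini(2) by (simp add: integral_sin_law[OF assms])
qed

lemma
  assumes "\<mu> \<in> U" and "admissible_weight \<omega>"
  shows integrable_K10: "integrable (law F \<mu>) (K10 F \<omega> 0 t)"
    and psi10_eq: "psi10 F \<omega> 0 t \<mu> = (LBINT s:{-1..1}. \<omega> s * cos (t * s * \<mu>))"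
proof -
  interpret real_distribution "law F \<mu>" by (rule real_distribution_law[OF assms(1)])
  have \<omega>: "integrable lborel (\<lambda>s. indicator {-1..1} s * \<omega> s)" "\<And>s. s \<in> {-1..1} \<Longrightarrow> 0 \<le> \<omega> s"
    using assms(2) by (auto simp: admissible_weight_def set_integrable_def)
  then have [measurable]: "(\<lambda>s. indicator {-1..1} s * \<omega> s) \<in> borel_measurable borel"
    using borel_measurable_integrable by force
  obtain m where m: "m > 0" "\<And>u. u \<in> {-\<bar>t\<bar>..\<bar>t\<bar>} \<Longrightarrow> m \<le> r F 0 u"
    using r_bounded_below by metis
  have v: "set_integrable lborel {-1..1} (\<lambda>s. \<omega> s / m)"
    using \<omega>(1) by (simp add: set_integrable_def)
  have meas: "(\<lambda>(x, s). indicator {-1..1} s * (\<omega> s * cos (t * s * x) / r F 0 (t * s)))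
      \<in> borel_measurable (law F \<mu> \<Otimes>\<^sub>M lborel)"
  proof -
    have "(\<lambda>(x, s). (indicator {-1..1} s * \<omega> s) * cos (t * s * x) / r F 0 (t * s))
      \<in> borel_measurable (law F \<mu> \<Otimes>\<^sub>M lborel)"
      by measurable
    then show ?thesis by (simp add: mult.assoc)
  qed
  have bound: "\<bar>\<omega> s * cos (t * s * x) / r F 0 (t * s)\<bar> \<le> 1 * (\<omega> s / m)"
    if s: "s \<in> {-1..1}" for s x
  proof -
    have "\<bar>t * s\<bar> \<le> \<bar>t\<bar>"
      using s mult_left_le[of "\<bar>s\<bar>" "\<bar>t\<bar>"] by (simp add: abs_mult abs_le_iff)
    then have "m \<le> r F 0 (t * s)"
      by (intro m) auto
    moreover have "\<bar>\<omega> s * cos (t * s * x)\<bar> \<le> \<omega> s"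
      using \<omega>(2)[OF s] by (simp add: abs_mult mult_left_le)
    ultimately show ?thesis
      using m(1) \<omega>(2)[OF s] by (simp add: abs_divide frac_le)
  qed
  note swap = set_integral_swap_dominated[OF sigma_finite_measure_axioms meas _ v bound]
  show "integrable (law F \<mu>) (K10 F \<omega> 0 t)"
    using swap(1) by (simp add: K10_def[abs_def])
  have "psi10 F \<omega> 0 t \<mu> = (LBINT s:{-1..1}. (LINT x|law F \<mu>. \<omega> s * cos (t * s * x) / r F 0 (t * s)))"
    using swap(2) by (simp add: psi10_def K10_def)
  also have "\<dots> = (LBINT s:{-1..1}. \<omega> s * cos (t * s * \<mu>))"
    using integral_cos_law[OF assms(1)] by simp
  finally show "psi10 F \<omega> 0 t \<mu> = (LBINT s:{-1..1}. \<omega> s * cos (t * s * \<mu>))" .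
qed

lemma integrable_K1_dagger:
  assumes "\<mu> \<in> U"
  shows "integrable (law F \<mu>) (K1_dagger F t)"
  unfolding K1_dagger_eq[abs_def]
  by (intro integrable_of_real integrable_mult_right integrable_sine_kernel assms)

lemma psi1_eq:
  assumes "\<mu> \<in> U"
  shows "psi1 F t \<mu> = of_real (1 / pi * (LBINT y=0..t. sin (\<mu> * y) / y))"
  unfolding psi1_def K1_dagger_eq integral_complex_of_real integral_mult_right_zero
    integral_sine_kernel[OF assms] sine_integral_rescale ..

end

section \<open>The discriminant and matching functions for the one-sided null\<close>

theorem theorem4:
  fixes U :: "real set" and F :: "real \<Rightarrow> real \<Rightarrow> real" and \<omega> :: "real \<Rightarrow> real"
  assumes "type_I_location_shift_family U F"
    and "admissible_weight \<omega>"
    and "\<forall>x. F 0 differentiable (at x)"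
    and "\<forall>\<mu>\<in>U. integrable (law F \<mu>) (\<lambda>x. \<bar>x\<bar>)"
    and "\<forall>t>0. (\<integral>\<^sup>+y\<in>{0..t}. ennreal (1 / y) *
           (\<integral>\<^sup>+s\<in>{-1..1}. ennreal \<bar>deriv (\<lambda>s. 1 / r F 0 (y * s)) s\<bar> \<partial>lborel) \<partial>lborel) < \<infinity>"
  shows "(\<forall>t x. iterated_integrable {0..1} {-1..1} (K1_dagger_integrand F t x)) \<and>
    (\<forall>\<mu>\<in>U. \<forall>t. integrable (law F \<mu>) (K1_dagger F t) \<and>
       psi1 F t \<mu> = complex_of_real (1 / pi * (LBINT y=0..t. sin (\<mu> * y) / y))) \<and>
    discriminant_matching_pair U F ({..<0} \<inter> U) (psi_one_sided F \<omega>) (K_one_sided F \<omega>) \<and>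
    (\<forall>t x. iterated_integrable {0..1} {-1..1} (K1_integrand F t x) \<and>
       Re (K1_dagger F t x) =
         1 / (2 * pi) * iterated_integral {0..1} {-1..1} (K1_integrand F t x))"
proof -
  have "0 \<in> U"
    using assms(1) by (simp add: type_I_location_shift_family_def)
  then have "integrable (law F 0) (\<lambda>x. \<bar>x\<bar>)"
    using assms(4) by blast
  then have "integrable (law F 0) (\<lambda>x. x)"
    by (rule Bochner_Integration.integrable_bound) auto
  with assms(1) interpret integrable_type_I_family U F
    by unfold_locales
  have "discriminant_matching_pair U F ({..<0} \<inter> U) (psi_one_sided F \<omega>) (K_one_sided F \<omega>)"
    unfolding discriminant_matching_pair_def
  proof (intro ballI conjI allI)
    fix \<mu> assume \<mu>: "\<mu> \<in> U"
    interpret law: real_distribution "law F \<mu>" by (rule real_distribution_law[OF \<mu>])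
    have "((\<lambda>t::real. 1/2 - 1 / pi * (LBINT y=0..t. sin (\<mu> * y) / y)
        - 1/2 * (LBINT s:{-1..1}. \<omega> s * cos (t * s * \<mu>))) \<longlongrightarrow>
        1/2 - sgn \<mu> / 2 - 1/2 * (if \<mu> = 0 then 1 else 0)) at_top"
      by (intro tendsto_intros sine_integral_limit admissible_weight_limit assms(2))
    also have "1/2 - sgn \<mu> / 2 - 1/2 * (if \<mu> = 0 then 1 else 0) = indicator ({..<0} \<inter> U) \<mu>"
      using \<mu> by (auto simp: sgn_if split: split_indicator)
    finally show "((\<lambda>t. psi_one_sided F \<omega> t \<mu>) \<longlongrightarrow> indicator ({..<0} \<inter> U) \<mu>) at_top"
      by (simp add: psi_one_sided_def psi1_eq[OF \<mu>] psi10_eq[OF \<mu> assms(2)])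
    fix t
    note [simp] = integrable_K10[OF \<mu> assms(2)] integrable_K1_dagger[OF \<mu>]
    show "integrable (law F \<mu>) (K_one_sided F \<omega> t)"
      unfolding K_one_sided_def[abs_def]
      by (intro Bochner_Integration.integrable_diff integrable_mult_right integrable_Re law.integrable_const) auto
    show "psi_one_sided F \<omega> t \<mu> = (LINT x|law F \<mu>. K_one_sided F \<omega> t x)"
      unfolding K_one_sided_def psi_one_sided_def psi1_def psi10_def
      using law.prob_space by simp
  qed
  moreover have "Re (K1_dagger F t x) =
      1 / (2 * pi) * iterated_integral {0..1} {-1..1} (K1_integrand F t x)" for t x
    by (simp add: K1_dagger_eq iterated_integral_K1)
  ultimately show ?thesis
    using iterated_integrable_K1_dagger iterated_integrable_K1 integrable_K1_dagger psi1_eq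
    by blast
qed

end
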